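(* Let $d\in\{\triangle,\delta\}$ and let $n,m_1,m_2\ge 1$ be integers. Let $S,S_1,S_2,T_1,T_2\in B(\mathcal H)$ be such that $S^{*n}\,d^{m_i}_{T_i,S_i}(I)\,S^n=0$, $SS_i=S_iS$ and $ST_i^*=T_i^*S$ for $i=1,2$, and $S_1S_2=S_2S_1$, $T_1T_2=T_2T_1$. Then $$S^{*n}\,d^{\,m_1+m_2-1}_{T_1T_2,\,S_1S_2}(I)\,S^n=0 .$$
   Context: $\mathcal H$ is a complex infinite dimensional Hilbert space. For $T,S\in B(\mathcal H)$, $\triangle^m_{T,S}(I)=\sum_{j=0}^m(-1)^j\binom mj T^{m-j}S^{m-j}$ and $\delta^m_{T,S}(I)=\sum_{j=0}^m(-1)^j\binom mj T^{m-j}S^{j}$; $d$ denotes either $\triangle$ or $\delta$ (the same choice throughout). *)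

theory Defs
  imports "HOL-Analysis.Analysis"
begin

(* The inner product is complex linear in the first argument; norm_sq_cinner says that it
   induces the given norm, so it is positive definite, and banach is completeness. *)
class complex_hilbert_space = banach +
  fixes scaleC :: "complex \<Rightarrow> 'a \<Rightarrow> 'a" (infixr "*\<^sub>C" 75)
    and cinner :: "'a \<Rightarrow> 'a \<Rightarrow> complex"
  assumes scaleC_add_right: "c *\<^sub>C (x + y) = c *\<^sub>C x + c *\<^sub>C y"
    and scaleC_add_left: "(c + d) *\<^sub>C x = c *\<^sub>C x + d *\<^sub>C x"
    and scaleC_scaleC: "c *\<^sub>C (d *\<^sub>C x) = (c * d) *\<^sub>C x"
    and scaleC_one: "1 *\<^sub>C x = x"
    and scaleR_scaleC: "r *\<^sub>R x = complex_of_real r *\<^sub>C x"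
    and cinner_commute: "cinner x y = cnj (cinner y x)"
    and cinner_add_left: "cinner (x + y) z = cinner x z + cinner y z"
    and cinner_scaleC_left: "cinner (c *\<^sub>C x) y = c * cinner x y"
    and norm_sq_cinner: "cinner x x = complex_of_real ((norm x)\<^sup>2)"

global_interpretation complex_vector:
  vector_space "scaleC :: complex \<Rightarrow> 'a \<Rightarrow> 'a::complex_hilbert_space"
  by unfold_locales
    (simp_all add: scaleC_add_right scaleC_add_left scaleC_scaleC scaleC_one)

definition infinite_dimensional :: "'a::complex_hilbert_space itself \<Rightarrow> bool" where
  "infinite_dimensional _ \<longleftrightarrow> (\<nexists>B :: 'a set. finite B \<and> complex_vector.span B = UNIV)"

subsection \<open>Consequences of the inner product axioms\<close>

lemma cinner_add_right:
  "cinner x (y + z) = cinner x y + cinner (x::'a::complex_hilbert_space) z"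
  by (metis cinner_add_left cinner_commute complex_cnj_add)

lemma cinner_scaleC_right:
  "cinner x (c *\<^sub>C y) = cnj c * cinner (x::'a::complex_hilbert_space) y"
  by (metis cinner_commute cinner_scaleC_left complex_cnj_mult)

lemma cinner_scaleR_left:
  "cinner (r *\<^sub>R x) y = complex_of_real r * cinner (x::'a::complex_hilbert_space) y"
  by (simp add: scaleR_scaleC cinner_scaleC_left)

lemma cinner_scaleR_right:
  "cinner x (r *\<^sub>R y) = complex_of_real r * cinner (x::'a::complex_hilbert_space) y"
  by (simp add: scaleR_scaleC cinner_scaleC_right)

lemma cinner_minus_left: "cinner (- x) y = - cinner (x::'a::complex_hilbert_space) y"
  using cinner_scaleR_left[of "-1" x y] by simp

lemma cinner_diff_left:
  "cinner (x - y) z = cinner x z - cinner (y::'a::complex_hilbert_space) z"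
  using cinner_add_left[of x "- y" z] by (simp add: cinner_minus_left)

lemma cinner_diff_right:
  "cinner z (x - y) = cinner z x - cinner z (y::'a::complex_hilbert_space)"
  by (metis cinner_commute cinner_diff_left complex_cnj_diff)

lemma scaleC_minus_right: "c *\<^sub>C (- x) = - (c *\<^sub>C (x::'a::complex_hilbert_space))"
  by (rule complex_vector.scale_minus_right)

lemma norm_add_sq:
  "(norm (x + y))\<^sup>2 = (norm x)\<^sup>2 + 2 * Re (cinner x y) + (norm (y::'a::complex_hilbert_space))\<^sup>2"
proof -
  have "(norm (x + y))\<^sup>2 = Re (cinner (x + y) (x + y))"
    by (simp add: norm_sq_cinner)
  also have "\<dots> = (norm x)\<^sup>2 + Re (cinner x y) + Re (cinner y x) + (norm y)\<^sup>2"
    unfolding cinner_add_left cinner_add_right by (simp add: norm_sq_cinner)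
  also have "Re (cinner y x) = Re (cinner x y)"
    by (subst cinner_commute) simp
  finally show ?thesis by simp
qed

lemma Re_cinner_le: "Re (cinner x y) \<le> norm x * norm (y::'a::complex_hilbert_space)"
proof -
  have "(norm (x + y))\<^sup>2 \<le> (norm x + norm y)\<^sup>2"
    by (intro power_mono norm_triangle_ineq) auto
  then show ?thesis
    unfolding norm_add_sq by (simp add: power2_eq_square algebra_simps)
qed

lemma norm_scaleC: "norm (c *\<^sub>C x) = cmod c * norm (x::'a::complex_hilbert_space)"
proof -
  have "complex_of_real ((norm (c *\<^sub>C x))\<^sup>2) = (c * cnj c) * complex_of_real ((norm x)\<^sup>2)"
    unfolding norm_sq_cinner[symmetric]
    by (simp add: cinner_scaleC_left cinner_scaleC_right)
  also have "\<dots> = complex_of_real ((cmod c * norm x)\<^sup>2)"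
    by (simp only: complex_norm_square[symmetric] power_mult_distrib of_real_mult of_real_power)
  finally have "(norm (c *\<^sub>C x))\<^sup>2 = (cmod c * norm x)\<^sup>2"
    by (simp only: of_real_eq_iff)
  then show ?thesis by (simp add: power2_eq_iff_nonneg)
qed

lemma cinner_ext:
  fixes x y :: "'a::complex_hilbert_space"
  assumes "\<And>z. cinner z x = cinner z y"
  shows "x = y"
proof -
  have "cinner (x - y) (x - y) = 0"
    using assms[of "x - y"] by (simp add: cinner_diff_right)
  then show ?thesis by (simp add: norm_sq_cinner)
qed

theorem riesz_representation:
  fixes f :: "'a::complex_hilbert_space \<Rightarrow> complex"
  assumes add: "\<And>x y. f (x + y) = f x + f y"
    and scale: "\<And>c x. f (c *\<^sub>C x) = c * f x"
    and bound: "\<And>x. cmod (f x) \<le> K * norm x"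
  obtains z where "\<And>x. f x = cinner x z"
proof -
  define J where "J = (\<lambda>x. (norm x)\<^sup>2 - 2 * Re (f x))"
  have fR: "f (r *\<^sub>R x) = complex_of_real r * f x" for r x
    by (simp add: scaleR_scaleC scale)
  have lin: "bounded_linear f"
    by (rule bounded_linear_intro[of f K])
      (simp_all add: add fR scaleR_conv_of_real bound mult.commute)
  have J_ge: "J x \<ge> - K\<^sup>2" for x
  proof -
    have "Re (f x) \<le> K * norm x"
      using complex_Re_le_cmod[of "f x"] bound[of x] by linarith
    moreover have "(norm x - K)\<^sup>2 \<ge> 0" by simp
    ultimately show ?thesis
      by (simp add: J_def power2_eq_square algebra_simps)
  qed
  have bdd: "bdd_below (range J)"
    using J_ge by (intro bdd_belowI[of _ "- K\<^sup>2"]) auto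
  define m where "m = Inf (range J)"
  have m_le: "m \<le> J x" for x
    unfolding m_def by (rule cInf_lower) (use bdd in auto)
  have "\<exists>x. J x < m + 1 / real (Suc n)" for n
  proof -
    have "Inf (range J) < m + 1 / real (Suc n)" by (simp add: m_def)
    then show ?thesis
      by (subst (asm) cInf_less_iff) (use bdd in auto)
  qed
  then obtain X where X: "\<And>n. J (X n) < m + 1 / real (Suc n)" by metis
  have par: "(norm (x - y))\<^sup>2 \<le> 2 * (J x + J y - 2 * m)" for x y
  proof -
    have 1: "J ((1/2) *\<^sub>R (x + y)) = (norm (x + y))\<^sup>2 / 4 - Re (f x + f y)"
      unfolding J_def fR add by (simp add: power_divide power_mult_distrib add_divide_distrib)
    have 2: "(norm (x - y))\<^sup>2 = (norm x)\<^sup>2 - 2 * Re (cinner x y) + (norm y)\<^sup>2"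
    proof -
      have "cinner x (- y) = - cinner x y"
        using cinner_scaleR_right[of x "-1" y] by simp
      then show ?thesis using norm_add_sq[of x "- y"] by simp
    qed
    show ?thesis
      using m_le[of "(1/2) *\<^sub>R (x + y)"]
      by (simp only: 1 norm_add_sq 2) (simp add: J_def field_simps)
  qed
  have "Cauchy X"
  proof (rule metric_CauchyI)
    fix e :: real assume e: "e > 0"
    obtain N where N: "1 / real (Suc N) < e\<^sup>2 / 4"
      using nat_approx_posE[of "e\<^sup>2 / 4"] e by auto
    have "dist (X p) (X q) < e" if "p \<ge> N" "q \<ge> N" for p q
    proof -
      have "J (X k) < m + e\<^sup>2 / 4" if "k \<ge> N" for k
      proof -
        have "1 / real (Suc k) \<le> 1 / real (Suc N)"
          using that by (intro divide_left_mono) auto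
        then show ?thesis using X[of k] N by linarith
      qed
      from this[OF \<open>p \<ge> N\<close>] this[OF \<open>q \<ge> N\<close>] par[of "X p" "X q"]
      have "(norm (X p - X q))\<^sup>2 < e\<^sup>2" by (simp add: field_simps)
      then show ?thesis
        using e by (simp add: dist_norm power2_less_imp_less)
    qed
    then show "\<exists>M. \<forall>p\<ge>M. \<forall>q\<ge>M. dist (X p) (X q) < e" by blast
  qed
  then obtain z where z: "X \<longlonglongrightarrow> z"
    using Cauchy_convergent_iff convergent_def by blast
  have Jz: "J z = m"
  proof (rule antisym[OF _ m_le])
    have "(\<lambda>n. J (X n)) \<longlonglongrightarrow> J z"
      unfolding J_def by (intro tendsto_intros z bounded_linear.tendsto[OF lin])
    moreover have "(\<lambda>n. m + 1 / real (Suc n)) \<longlonglongrightarrow> m + 0"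
      by (intro tendsto_add tendsto_const) (rule LIMSEQ_Suc[OF lim_1_over_n])
    ultimately show "J z \<le> m"
      using LIMSEQ_le[of "\<lambda>n. J (X n)" "J z" "\<lambda>n. m + 1 / real (Suc n)" "m + 0"] X
      by (auto intro: less_imp_le)
  qed
  have Re_eq: "Re (f y) = Re (cinner y z)" for y
  proof -
    define a where "a = Re (cinner z y) - Re (f y)"
    have q: "0 \<le> t\<^sup>2 * (norm y)\<^sup>2 + 2 * t * a" for t
    proof -
      have "J (z + t *\<^sub>R y) = J z + t\<^sup>2 * (norm y)\<^sup>2 + 2 * t * a"
        unfolding J_def norm_add_sq add fR cinner_scaleR_right a_def
        by (simp add: power_mult_distrib algebra_simps)
      then show ?thesis using m_le[of "z + t *\<^sub>R y"] Jz by simp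
    qed
    define w where "w = (norm y)\<^sup>2 + 1"
    have w: "w > 0" unfolding w_def by (simp add: add_nonneg_pos)
    have "0 \<le> (- a / w)\<^sup>2 * (w - 1) + 2 * (- a / w) * a"
      using q[of "- a / w"] by (simp add: w_def)
    also have "\<dots> = - (a\<^sup>2 / w) - (a / w)\<^sup>2"
      using w by (simp add: field_simps power2_eq_square)
    finally have "(a / w)\<^sup>2 + a\<^sup>2 / w \<le> 0" by simp
    moreover have "a\<^sup>2 / w \<ge> 0" using w by simp
    ultimately have "(a / w)\<^sup>2 \<le> 0" by linarith
    then have "a = 0" using w by simp
    moreover have "Re (cinner z y) = Re (cinner y z)"
      by (subst cinner_commute) simp
    ultimately show ?thesis by (simp add: a_def)
  qed
  have "f x = cinner x z" for x
  proof (rule complex_eqI)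
    show "Im (f x) = Im (cinner x z)"
      using Re_eq[of "\<i> *\<^sub>C x"] by (simp add: scale cinner_scaleC_left)
  qed (rule Re_eq)
  then show ?thesis by (rule that)
qed

subsection \<open>The algebra of bounded operators\<close>

typedef (overloaded) 'a bop =
  "{f :: 'a::complex_hilbert_space \<Rightarrow> 'a. bounded_linear f \<and> (\<forall>c x. f (c *\<^sub>C x) = c *\<^sub>C f x)}"
  morphisms bop_apply Bop
  by (rule exI[of _ "\<lambda>x. x"]) (auto intro: bounded_linear_ident)

setup_lifting type_definition_bop

lemma bop_eqI: "(\<And>x. bop_apply A x = bop_apply B x) \<Longrightarrow> A = B"
  by transfer blast

instantiation bop :: (complex_hilbert_space) real_algebra
begin

lift_definition zero_bop :: "'a bop" is "\<lambda>x. 0"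
  by (auto intro: bounded_linear_zero)

lift_definition plus_bop :: "'a bop \<Rightarrow> 'a bop \<Rightarrow> 'a bop" is "\<lambda>f g x. f x + g x"
  by (auto intro: bounded_linear_add simp: scaleC_add_right)

lift_definition uminus_bop :: "'a bop \<Rightarrow> 'a bop" is "\<lambda>f x. - f x"
  by (auto intro: bounded_linear_minus simp: scaleC_minus_right)

lift_definition minus_bop :: "'a bop \<Rightarrow> 'a bop \<Rightarrow> 'a bop" is "\<lambda>f g x. f x - g x"
  by (auto intro: bounded_linear_sub simp: complex_vector.scale_right_diff_distrib)

lift_definition times_bop :: "'a bop \<Rightarrow> 'a bop \<Rightarrow> 'a bop" is "\<lambda>f g x. f (g x)"
  by (auto intro: bounded_linear_compose)

lift_definition scaleR_bop :: "real \<Rightarrow> 'a bop \<Rightarrow> 'a bop" is "\<lambda>r f x. r *\<^sub>R f x"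
  by (auto intro: bounded_linear_const_scaleR)
    (simp add: scaleR_scaleC scaleC_scaleC mult.commute)

instance
proof
  fix A B C :: "'a bop" and r s :: real
  show "A + B + C = A + (B + C)" by transfer (simp add: algebra_simps)
  show "A + B = B + A" by transfer (simp add: algebra_simps)
  show "0 + A = A" by transfer simp
  show "- A + A = 0" by transfer simp
  show "A - B = A + - B" by transfer simp
  show "r *\<^sub>R (A + B) = r *\<^sub>R A + r *\<^sub>R B" by transfer (simp add: algebra_simps)
  show "(r + s) *\<^sub>R A = r *\<^sub>R A + s *\<^sub>R A" by transfer (simp add: algebra_simps)
  show "r *\<^sub>R s *\<^sub>R A = (r * s) *\<^sub>R A" by transfer simp
  show "1 *\<^sub>R A = A" by transfer simp
  show "A * B * C = A * (B * C)" by transfer simp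
  show "(A + B) * C = A * C + B * C" by transfer simp
  show "A * (B + C) = A * B + A * C" by transfer (simp add: linear_simps)
  show "r *\<^sub>R A * B = r *\<^sub>R (A * B)" by transfer simp
  show "A * r *\<^sub>R B = r *\<^sub>R (A * B)" by transfer (simp add: linear_simps)
qed

end

(* Not ring_1: on the zero space 0 = 1. *)
instantiation bop :: (complex_hilbert_space) monoid_mult
begin

lift_definition one_bop :: "'a bop" is "\<lambda>x. x"
  by (auto intro: bounded_linear_ident)

instance
  by standard (transfer; simp)+

end

subsection \<open>Adjoints\<close>

definition adj :: "'a::complex_hilbert_space bop \<Rightarrow> 'a bop" where
  "adj T = (THE A. \<forall>x y. cinner (bop_apply T x) y = cinner x (bop_apply A y))"

lemma ex1_adj:
  fixes T :: "'a::complex_hilbert_space bop"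
  shows "\<exists>!A. \<forall>x y. cinner (bop_apply T x) y = cinner x (bop_apply A y)"
proof (rule ex_ex1I)
  have T: "bounded_linear (bop_apply T)" "\<And>c x. bop_apply T (c *\<^sub>C x) = c *\<^sub>C bop_apply T x"
    using bop_apply[of T] by auto
  obtain K where K: "K \<ge> 0" "\<And>x. norm (bop_apply T x) \<le> norm x * K"
    using bounded_linear.nonneg_bounded[OF T(1)] by blast
  have cs: "cmod (cinner x y) \<le> norm x * norm y" for x y :: 'a
  proof (cases "cinner x y = 0")
    case False
    define u where "u = cnj (cinner x y) / cmod (cinner x y)"
    have u: "cmod u = 1" using False by (simp add: u_def norm_divide)
    have "cinner (u *\<^sub>C x) y = cmod (cinner x y)"
      using False complex_norm_square[of "cinner x y"]
      by (simp add: cinner_scaleC_left u_def field_simps power2_eq_square)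
    then show ?thesis
      using Re_cinner_le[of "u *\<^sub>C x" y] by (simp add: norm_scaleC u)
  qed simp
  have "\<exists>z. \<forall>x. cinner (bop_apply T x) y = cinner x z" for y
  proof (rule riesz_representation[of "\<lambda>x. cinner (bop_apply T x) y" "K * norm y"])
    fix x
    have "cmod (cinner (bop_apply T x) y) \<le> norm (bop_apply T x) * norm y" by (rule cs)
    also have "\<dots> \<le> norm x * K * norm y" by (intro mult_right_mono K) auto
    finally show "cmod (cinner (bop_apply T x) y) \<le> K * norm y * norm x"
      by (simp add: mult_ac)
  qed (use T in \<open>auto simp: linear_simps cinner_add_left cinner_scaleC_left\<close>)
  then obtain a where a: "\<And>x y. cinner (bop_apply T x) y = cinner x (a y)" by metis
  have aC: "a (c *\<^sub>C x) = c *\<^sub>C a x" for c x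
    by (rule cinner_ext) (simp add: a[symmetric] cinner_scaleC_right)
  have bl: "bounded_linear a"
  proof (rule bounded_linear_intro)
    show "a (x + y) = a x + a y" for x y
      by (rule cinner_ext) (simp add: a[symmetric] cinner_add_right)
    show "a (r *\<^sub>R x) = r *\<^sub>R a x" for r x
      by (simp add: scaleR_scaleC aC)
    show "norm (a y) \<le> norm y * K" for y
    proof (cases "norm (a y) = 0")
      case False
      have "(norm (a y))\<^sup>2 = Re (cinner (bop_apply T (a y)) y)"
        by (simp add: a norm_sq_cinner)
      also have "\<dots> \<le> norm (bop_apply T (a y)) * norm y" by (rule Re_cinner_le)
      also have "\<dots> \<le> norm (a y) * K * norm y" by (intro mult_right_mono K) auto
      finally have "norm (a y) * norm (a y) \<le> norm (a y) * (norm y * K)"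
        by (simp add: power2_eq_square mult_ac)
      then show ?thesis using False by (simp add: mult_le_cancel_left)
    qed (use K in auto)
  qed
  show "\<exists>A. \<forall>x y. cinner (bop_apply T x) y = cinner x (bop_apply A y)"
    using a bl aC by (intro exI[of _ "Bop a"]) (simp add: Bop_inverse)
  show "A = B"
    if "\<forall>x y. cinner (bop_apply T x) y = cinner x (bop_apply A y)"
       "\<forall>x y. cinner (bop_apply T x) y = cinner x (bop_apply B y)" for A B
    using that by (intro bop_eqI cinner_ext) metis
qed

lemma cinner_adj: "cinner (bop_apply T x) y = cinner x (bop_apply (adj T) y)"
  using theI'[OF ex1_adj[of T]] unfolding adj_def by blast

subsection \<open>The operator polynomials\<close>

(* These are the values at the identity operator I of the m-th powers of the elementary
   operators X |-> T X S - X and X |-> T X - X S, respectively. *)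
definition triangle_op :: "nat \<Rightarrow> 'a::complex_hilbert_space bop \<Rightarrow> 'a bop \<Rightarrow> 'a bop" where
  "triangle_op m T S =
    (\<Sum>j=0..m. ((-1) ^ j * real (m choose j)) *\<^sub>R (T ^ (m - j) * S ^ (m - j)))"

definition delta_op :: "nat \<Rightarrow> 'a::complex_hilbert_space bop \<Rightarrow> 'a bop \<Rightarrow> 'a bop" where
  "delta_op m T S =
    (\<Sum>j=0..m. ((-1) ^ j * real (m choose j)) *\<^sub>R (T ^ (m - j) * S ^ j))"

end

theory Submission
  imports Defs
begin

text \<open>
  Write \<open>L A\<close> and \<open>R A\<close> for left and right multiplication by \<open>A\<close> on the algebra of operators.
  According to the choice of \<open>d\<close>, \<open>d m T S\<close> is the value at the identity of the \<open>m\<close>-th power of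
  \<open>D T S = L T - R S\<close> or of \<open>D T S = L T \<circ> R S - id\<close>; this is the binomial theorem for
  commuting linear maps (\<open>funpow_diff_binomial\<close>). Left multiplications commute with right ones, so
  under the hypotheses all the maps \<open>L T\<^sub>i\<close> and \<open>R S\<^sub>i\<close> commute with each other.

  With \<open>f = D T\<^sub>1 S\<^sub>1\<close> and \<open>g = D T\<^sub>2 S\<^sub>2\<close>, the map \<open>h\<close> of the products telescopes in both cases:
  \<open>L T\<^sub>1 \<circ> L T\<^sub>2 - R S\<^sub>1 \<circ> R S\<^sub>2 = f \<circ> L T\<^sub>2 + R S\<^sub>1 \<circ> g\<close>, and for \<open>P\<^sub>i = L T\<^sub>i \<circ> R S\<^sub>i\<close>
  also \<open>P\<^sub>1 \<circ> P\<^sub>2 - id = f \<circ> P\<^sub>2 + g\<close>. Expanding \<open>h\<close> to the power \<open>m\<^sub>1 + m\<^sub>2 - 1\<close>, every term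
  contains \<open>f\<close> at least \<open>m\<^sub>1\<close> times or \<open>g\<close> at least \<open>m\<^sub>2\<close> times.

  The operators \<open>X\<close> with \<open>S\<^sup>*\<^sup>n X S\<^sup>n = 0\<close> form an additive group \<open>N\<close>, and
  \<open>N\<close> is invariant under each \<open>R S\<^sub>i\<close>, since \<open>S\<close> commutes with \<open>S\<^sub>i\<close>, and under each \<open>L T\<^sub>i\<close>,
  since \<open>S\<^sup>*\<close> commutes with \<open>T\<^sub>i\<close> (\<open>adj_commute\<close>). By hypothesis the \<open>m\<^sub>1\<close>-th power of \<open>f\<close> and
  the \<open>m\<^sub>2\<close>-th power of \<open>g\<close> send the identity into \<open>N\<close>, hence so does each term of the expansion
  (\<open>funpow_telescope_mem\<close>).
\<close>

lemma funpow_commute_apply: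
  assumes "\<And>x. f (g x) = g (f x)"
  shows "(f ^^ k) (g x) = g ((f ^^ k) x)"
  by (induction k) (simp_all add: assms)

lemma funpow_commute_funpow:
  assumes "\<And>x. f (g x) = g (f x)"
  shows "(f ^^ k) ((g ^^ l) x) = (g ^^ l) ((f ^^ k) x)"
  by (induction l) (simp_all add: funpow_commute_apply[of f g, OF assms])

lemma funpow_split:
  assumes "m \<le> k"
  shows "(f ^^ k) x = (f ^^ (k - m)) ((f ^^ m) x)"
  using assms by (metis comp_apply funpow_add le_add_diff_inverse2)

lemma funpow_mem:
  assumes "x \<in> N" and "\<And>y. y \<in> N \<Longrightarrow> f y \<in> N"
  shows "(f ^^ k) x \<in> N"
  by (induction k) (simp_all add: assms)

lemma funpow_additive:
  fixes f :: "'v::ab_group_add \<Rightarrow> 'v"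
  assumes "\<And>x y. f (x + y) = f x + f y"
  shows "(f ^^ k) (x + y) = (f ^^ k) x + (f ^^ k) y"
  by (induction k) (simp_all add: assms)

text \<open>
  An invariant subgroup \<open>N\<close> in place of a kernel means that only sums, and no coefficients, have to
  be controlled. The expansion of the power of \<open>h\<close> is then replaced by an induction that peels off
  one factor \<open>h\<close> at a time: each summand of \<open>h\<close> raises the exponent of \<open>f\<close> or that of \<open>g\<close> by one,
  so the total number of factors \<open>f\<close>, \<open>g\<close> and \<open>h\<close> is preserved.
\<close>

lemma funpow_telescope_mem:
  fixes f g a b h :: "'v::ab_group_add \<Rightarrow> 'v"
  assumes N_add: "\<And>x y. x \<in> N \<Longrightarrow> y \<in> N \<Longrightarrow> x + y \<in> N"
    and N_inv: "\<And>x. x \<in> N \<Longrightarrow> f x \<in> N" "\<And>x. x \<in> N \<Longrightarrow> g x \<in> N"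
      "\<And>x. x \<in> N \<Longrightarrow> a x \<in> N" "\<And>x. x \<in> N \<Longrightarrow> b x \<in> N"
    and h: "\<And>x. h x = f (a x) + b (g x)"
    and h_add: "\<And>x y. h (x + y) = h x + h y"
    and fg: "\<And>x. f (g x) = g (f x)"
    and a: "\<And>x. f (a x) = a (f x)" "\<And>x. g (a x) = a (g x)" "\<And>x. h (a x) = a (h x)"
    and b: "\<And>x. f (b x) = b (f x)" "\<And>x. g (b x) = b (g x)" "\<And>x. h (b x) = b (h x)"
    and x: "(f ^^ m\<^sub>1) x \<in> N" "(g ^^ m\<^sub>2) x \<in> N"
  shows "(h ^^ (m\<^sub>1 + m\<^sub>2 - 1)) x \<in> N"
proof -
  have "(h ^^ k) ((f ^^ i) ((g ^^ j) x)) \<in> N" if "m\<^sub>1 + m\<^sub>2 - 1 \<le> i + j + k" for i j k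
    using that
  proof (induction k arbitrary: i j)
    case 0
    then consider "m\<^sub>1 \<le> i" | "m\<^sub>2 \<le> j" by linarith
    then show ?case
    proof cases
      case 1
      then have "(f ^^ i) ((g ^^ j) x) = (g ^^ j) ((f ^^ (i - m\<^sub>1)) ((f ^^ m\<^sub>1) x))"
        by (simp add: funpow_commute_funpow[of f g, OF fg] funpow_split[of m\<^sub>1 i f])
      then show ?thesis
        by (simp add: funpow_mem x N_inv)
    next
      case 2
      then have "(g ^^ j) x = (g ^^ (j - m\<^sub>2)) ((g ^^ m\<^sub>2) x)"
        by (rule funpow_split)
      then show ?thesis
        by (simp add: funpow_mem x N_inv)
    qed
  next
    case (Suc k)
    let ?y = "(f ^^ i) ((g ^^ j) x)"
    have "(h ^^ Suc k) ?y = (h ^^ k) (a (f ?y)) + (h ^^ k) (b (g ?y))"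
      by (simp only: funpow_Suc_right comp_apply h a(1) funpow_additive[of h, OF h_add])
    also have "\<dots> = a ((h ^^ k) ((f ^^ Suc i) ((g ^^ j) x))) + b ((h ^^ k) ((f ^^ i) ((g ^^ Suc j) x)))"
      by (simp add: funpow_commute_apply[of h a, OF a(3)] funpow_commute_apply[of h b, OF b(3)]
          funpow_commute_apply[of f g, OF fg])
    also have "\<dots> \<in> N"
      by (intro N_add N_inv Suc.IH) (use Suc.prems in auto)
    finally show ?case .
  qed
  from this[of 0 0] show ?thesis by simp
qed

lemma funpow_diff_binomial:
  fixes u v :: "'v::real_vector \<Rightarrow> 'v"
  assumes u: "linear u" and v: "linear v" and uv: "\<And>x. u (v x) = v (u x)"
  shows "((\<lambda>x. u x - v x) ^^ m) x
    = (\<Sum>j=0..m. ((-1) ^ j * real (m choose j)) *\<^sub>R (u ^^ (m - j)) ((v ^^ j) x))"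
proof (induction m)
  case 0
  show ?case by simp
next
  case (Suc m)
  define c where "c = (\<lambda>m j. (-1) ^ j * real (m choose j))"
  define e where "e = (\<lambda>p q. (u ^^ p) ((v ^^ q) x))"
  have ue: "u (e p q) = e (Suc p) q" and ve: "v (e p q) = e p (Suc q)" for p q
    by (simp_all add: e_def funpow_commute_apply[of u v, OF uv])
  have pascal: "c (Suc m) (Suc j) = c m (Suc j) - c m j" for j
    by (simp add: c_def algebra_simps)
  have "((\<lambda>x. u x - v x) ^^ Suc m) x
      = u (\<Sum>j\<le>m. c m j *\<^sub>R e (m - j) j) - v (\<Sum>j\<le>m. c m j *\<^sub>R e (m - j) j)"
    by (simp add: Suc.IH c_def e_def atLeast0AtMost)
  also have "v (\<Sum>j\<le>m. c m j *\<^sub>R e (m - j) j) = (\<Sum>j\<le>m. c m j *\<^sub>R e (m - j) (Suc j))"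
    by (simp add: linear_sum[OF v] linear_scale[OF v] ve)
  also have "u (\<Sum>j\<le>m. c m j *\<^sub>R e (m - j) j) = (\<Sum>j\<le>m. c m j *\<^sub>R e (Suc m - j) j)"
    by (simp add: linear_sum[OF u] linear_scale[OF u] ue Suc_diff_le)
  \<comment> \<open>The added term has the coefficient \<open>m choose Suc m\<close>, which is zero.\<close>
  also have "\<dots> = (\<Sum>j\<le>Suc m. c m j *\<^sub>R e (Suc m - j) j)"
    by (simp add: c_def)
  also have "\<dots> = e (Suc m) 0 + (\<Sum>j\<le>m. c m (Suc j) *\<^sub>R e (m - j) (Suc j))"
    by (subst sum.atMost_Suc_shift) (simp add: c_def)
  also have "\<dots> - (\<Sum>j\<le>m. c m j *\<^sub>R e (m - j) (Suc j))
      = e (Suc m) 0 + (\<Sum>j\<le>m. c (Suc m) (Suc j) *\<^sub>R e (m - j) (Suc j))"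
    by (simp add: pascal scaleR_diff_left sum_subtractf)
  also have "\<dots> = (\<Sum>j\<le>Suc m. c (Suc m) j *\<^sub>R e (Suc m - j) j)"
    by (subst sum.atMost_Suc_shift) (simp add: c_def)
  finally show ?case
    by (simp only: c_def e_def atLeast0AtMost)
qed

lemma funpow_mult_left: "((\<lambda>X. A * X) ^^ k) X = A ^ k * (X :: 'a::monoid_mult)"
  by (induction k) (simp_all add: mult.assoc)

lemma funpow_mult_right: "((\<lambda>X. X * A) ^^ k) X = (X :: 'a::monoid_mult) * A ^ k"
  by (induction k) (simp_all add: mult.assoc power_commutes)

lemma funpow_mult_both: "((\<lambda>X. A * X * B) ^^ k) X = A ^ k * X * (B :: 'a::monoid_mult) ^ k"
  by (induction k) (simp_all add: mult.assoc power_commutes)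

lemma delta_op_eq_funpow: "delta_op m T S = ((\<lambda>X. T * X - X * S) ^^ m) 1"
proof -
  have "linear (\<lambda>X. T * X)" and "linear (\<lambda>X. X * S)"
    by (auto intro!: linearI simp: algebra_simps)
  from funpow_diff_binomial[OF this] show ?thesis
    by (simp add: delta_op_def mult.assoc funpow_mult_left funpow_mult_right)
qed

lemma triangle_op_eq_funpow: "triangle_op m T S = ((\<lambda>X. T * X * S - X) ^^ m) 1"
proof -
  have "linear (\<lambda>X. T * X * S)" and "linear (\<lambda>X::'a bop. X)"
    by (auto intro!: linearI simp: algebra_simps)
  from funpow_diff_binomial[OF this] show ?thesis
    by (simp add: triangle_op_def funpow_mult_both flip: id_def)
qed

text \<open>
  This is the adjoint of the assumed identity; testing against vectors needs no algebraic rules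
  for adjoints of products.
\<close>

lemma adj_commute:
  assumes "S * adj T = adj T * S"
  shows "T * adj S = adj S * T"
proof (intro bop_eqI cinner_ext)
  have adj': "cinner x (bop_apply A y) = cinner (bop_apply (adj A) x) y" for A :: "'a bop" and x y
    by (metis cinner_adj cinner_commute)
  fix x z
  have "cinner z (bop_apply (T * adj S) x) = cinner (bop_apply (S * adj T) z) x"
    by (simp add: times_bop.rep_eq adj'[of _ T] flip: cinner_adj[of S])
  also have "\<dots> = cinner z (bop_apply (adj S * T) x)"
    unfolding assms by (simp add: times_bop.rep_eq adj'[of _ T] flip: cinner_adj[of S])
  finally show "cinner z (bop_apply (T * adj S) x) = cinner z (bop_apply (adj S * T) x)" .
qed

lemma power_commutes_left:
  fixes A B :: "'a::monoid_mult"
  assumes "A * B = B * A"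
  shows "A ^ k * B = B * A ^ k"
  using assms by (metis power_commuting_commutes)

theorem theorem4p2:
  fixes d :: "nat \<Rightarrow> 'a::complex_hilbert_space bop \<Rightarrow> 'a bop \<Rightarrow> 'a bop"
    and n m\<^sub>1 m\<^sub>2 :: nat
    and S S\<^sub>1 S\<^sub>2 T\<^sub>1 T\<^sub>2 :: "'a bop"
  assumes "infinite_dimensional TYPE('a)"
    and "d \<in> {triangle_op, delta_op}"
    and "n \<ge> 1" and "m\<^sub>1 \<ge> 1" and "m\<^sub>2 \<ge> 1"
    and "adj S ^ n * d m\<^sub>1 T\<^sub>1 S\<^sub>1 * S ^ n = 0"
    and "adj S ^ n * d m\<^sub>2 T\<^sub>2 S\<^sub>2 * S ^ n = 0"
    and "S * S\<^sub>1 = S\<^sub>1 * S" and "S * S\<^sub>2 = S\<^sub>2 * S"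
    and "S * adj T\<^sub>1 = adj T\<^sub>1 * S" and "S * adj T\<^sub>2 = adj T\<^sub>2 * S"
    and "S\<^sub>1 * S\<^sub>2 = S\<^sub>2 * S\<^sub>1" and "T\<^sub>1 * T\<^sub>2 = T\<^sub>2 * T\<^sub>1"
  shows "adj S ^ n * d (m\<^sub>1 + m\<^sub>2 - 1) (T\<^sub>1 * T\<^sub>2) (S\<^sub>1 * S\<^sub>2) * S ^ n = 0"
proof -
  define N where "N = {X. adj S ^ n * X * S ^ n = 0}"
  have N_add: "X + Y \<in> N" if "X \<in> N" "Y \<in> N" for X Y
    using that by (simp add: N_def algebra_simps)
  have N_diff: "X - Y \<in> N" if "X \<in> N" "Y \<in> N" for X Y
    using that by (simp add: N_def algebra_simps)
  have N_left: "T * X \<in> N" if "S * adj T = adj T * S" "X \<in> N" for T X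
  proof -
    have "adj S ^ n * (T * X) * S ^ n = T * (adj S ^ n * X * S ^ n)"
      using power_commutes_left[OF adj_commute[OF that(1), symmetric]] by (metis mult.assoc)
    then show ?thesis using that(2) by (simp add: N_def)
  qed
  have N_right: "X * A \<in> N" if "S * A = A * S" "X \<in> N" for A X
  proof -
    have "adj S ^ n * (X * A) * S ^ n = adj S ^ n * X * S ^ n * A"
      using power_commutes_left[OF that(1)] by (metis mult.assoc)
    then show ?thesis using that(2) by (simp add: N_def)
  qed
  note N_closed = N_diff N_left N_right assms(8-11)
  have SS: "S\<^sub>1 * (S\<^sub>2 * Y) = S\<^sub>2 * (S\<^sub>1 * Y)"
    and TT: "T\<^sub>1 * (T\<^sub>2 * Y) = T\<^sub>2 * (T\<^sub>1 * Y)" for Y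
    using assms(12,13) by (metis mult.assoc)+
  \<comment> \<open>Words in the operators are brought to a normal form with every \<open>S\<^sub>2\<close> before \<open>S\<^sub>1\<close> and every
      \<open>T\<^sub>2\<close> before \<open>T\<^sub>1\<close>; this decides all the commutation identities below.\<close>
  note expand = mult.assoc distrib_left distrib_right left_diff_distrib right_diff_distrib
    assms(12) SS TT
  have "d (m\<^sub>1 + m\<^sub>2 - 1) (T\<^sub>1 * T\<^sub>2) (S\<^sub>1 * S\<^sub>2) \<in> N"
    if "d m\<^sub>1 T\<^sub>1 S\<^sub>1 \<in> N" "d m\<^sub>2 T\<^sub>2 S\<^sub>2 \<in> N"
  proof (cases "d = triangle_op")
    case True
    show ?thesis
      using that unfolding True triangle_op_eq_funpow
      by (rule funpow_telescope_mem[OF N_add, where a = "\<lambda>X. T\<^sub>2 * X * S\<^sub>2" and b = "\<lambda>X. X", rotated -2])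
        (simp_all add: N_closed expand)
  next
    case False
    then have d: "d = delta_op"
      using assms(2) by simp
    show ?thesis
      using that unfolding d delta_op_eq_funpow
      by (rule funpow_telescope_mem[OF N_add, where a = "\<lambda>X. T\<^sub>2 * X" and b = "\<lambda>X. X * S\<^sub>1", rotated -2])
        (simp_all add: N_closed expand)
  qed
  then show ?thesis
    using assms(6,7) by (simp add: N_def)
qed

end
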